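(* Let $n\ge 2$, let $a,b\in\mathbb{C}$ with $b\neq 0$, and let $J_n$ be the $n\times n$ exchange matrix ($(J_n)_{i,j}=1$ if $i+j=n+1$, $0$ otherwise). Let $\widetilde{B}_n$ be the $n\times n$ tridiagonal matrix with diagonal $(a+b,a,\ldots,a,a+b)$ and all sub- and superdiagonal entries equal to $b$, and let $B_n:=J_n\widetilde{B}_n$, i.e. the anti-tridiagonal matrix with $(B_n)_{1,n}=(B_n)_{n,1}=a+b$, $(B_n)_{i,n+1-i}=a$ for $2\le i\le n-1$, all entries $(B_n)_{i,j}$ with $|i+j-(n+1)|=1$ equal to $b$, and all other entries $0$. Let $$\lambda_k=a+2b\cos\left(\frac{(k-1)\pi}{n}\right),\quad k=1,\ldots,n,$$ (the eigenvalues of $\widetilde{B}_n$), let $f_1=\frac1n$ and $f_k=\frac{2}{n}$ for $k=2,\ldots,n$. Let $r$ be a nonnegative integer (or any integer, if $B_n$ is invertible), and write $B_n^r=(v_{ij}(r))$. Then for all $i,j=1,\ldots,n$, $$v_{ij}(r)=\begin{cases}\displaystyle\sum_{k=1}^{n}f_k\lambda_k^{r}\,T_{\frac{2i-1}{2}}\!\left(\frac{\lambda_k-a}{2b}\right)T_{\frac{2j-1}{2}}\!\left(\frac{\lambda_k-a}{2b}\right), & r\text{ even},\\[2ex] \displaystyle\sum_{k=1}^{n}f_k\lambda_k^{r}\,T_{\frac{2(n-i)+1}{2}}\!\left(\frac{\lambda_k-a}{2b}\right)T_{\frac{2j-1}{2}}\!\left(\frac{\lambda_k-a}{2b}\right),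 & r\text{ odd}.\end{cases}$$
   Context: For a real number $\nu$ (here a half-integer) and $x\in[-1,1]$, $T_\nu(x)=\cos(\nu\arccos x)$ with $\arccos x\in[0,\pi]$; this extends the Chebyshev polynomials of the first kind. Note $\frac{\lambda_k-a}{2b}=\cos\frac{(k-1)\pi}{n}\in[-1,1]$, so $T_{\frac{2i-1}{2}}\!\left(\frac{\lambda_k-a}{2b}\right)=\cos\frac{(2i-1)(k-1)\pi}{2n}$. *)

theory Defs
  imports Complex_Main "Jordan_Normal_Form.Matrix"
begin

text \<open>Matrix entries are indexed from 0 in the library, so the entry in row \<open>i\<close> and column \<open>j\<close>
  (counted from 1) of \<open>A\<close> is \<open>A $$ (i - 1, j - 1)\<close>.\<close>

definition exchange_mat :: "nat \<Rightarrow> complex mat" where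
  "exchange_mat n = mat n n (\<lambda>(i, j). if (i + 1) + (j + 1) = n + 1 then 1 else 0)"

definition tridiag_mat :: "nat \<Rightarrow> complex \<Rightarrow> complex \<Rightarrow> complex mat" where
  "tridiag_mat n a b = mat n n (\<lambda>(i, j).
     if i = j then (if i = 0 \<or> i = n - 1 then a + b else a)
     else if i = j + 1 \<or> j = i + 1 then b
     else 0)"

definition antitridiag_mat :: "nat \<Rightarrow> complex \<Rightarrow> complex \<Rightarrow> complex mat" where
  "antitridiag_mat n a b = exchange_mat n * tridiag_mat n a b"

lemma antitridiag_mat_entry:
  assumes n: "n \<ge> 2" and i: "i \<in> {1..n}" and j: "j \<in> {1..n}"
  shows "antitridiag_mat n a b $$ (i - 1, j - 1) =
    (if i + j = n + 1 then (if i = 1 \<or> i = n then a + b else a)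
     else if \<bar>int i + int j - (int n + 1)\<bar> = 1 then b
     else 0)"
proof -
  have "antitridiag_mat n a b $$ (i - 1, j - 1) =
      (\<Sum>k = 0..<n. (if k = n - i then 1 else 0) * tridiag_mat n a b $$ (k, j - 1))"
    using i j unfolding antitridiag_mat_def exchange_mat_def tridiag_mat_def
    by (auto simp: scalar_prod_def intro!: sum.cong)
  also have "\<dots> = (\<Sum>k = 0..<n. if k = n - i then tridiag_mat n a b $$ (k, j - 1) else 0)"
    by (rule sum.cong) auto
  also have "\<dots> = tridiag_mat n a b $$ (n - i, j - 1)"
    using i n by simp
  also have "\<dots> = (if i + j = n + 1 then (if i = 1 \<or> i = n then a + b else a)
     else if \<bar>int i + int j - (int n + 1)\<bar> = 1 then b else 0)"
  proof -
    have ij: "n - i < n" "j - 1 < n" and diag: "n - i = j - 1 \<longleftrightarrow> i + j = n + 1"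
      and corner: "n - i = 0 \<or> n - i = n - 1 \<longleftrightarrow> i = 1 \<or> i = n"
      and off: "n - i = j - 1 + 1 \<or> j - 1 = n - i + 1 \<longleftrightarrow>
        \<bar>int i + int j - (int n + 1)\<bar> = 1"
      using i j n unfolding atLeastAtMost_iff by linarith+
    show ?thesis
      unfolding tridiag_mat_def index_mat(1)[OF ij] prod.case diag corner off ..
  qed
  finally show ?thesis .
qed

definition mat_inv :: "complex mat \<Rightarrow> complex mat" where
  "mat_inv A = (THE B. inverts_mat A B \<and> inverts_mat B A)"

lemma mat_inv:
  assumes "invertible_mat A"
  shows "inverts_mat A (mat_inv A)" "inverts_mat (mat_inv A) A"
proof -
  have dims: "B \<in> carrier_mat (dim_row A) (dim_row A)"
    if "inverts_mat A B" "inverts_mat B A" for B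
  proof -
    have "dim_col B = dim_row A"
      using arg_cong[OF that(1)[unfolded inverts_mat_def], of dim_col] by simp
    moreover have "dim_col A = dim_row B"
      using arg_cong[OF that(2)[unfolded inverts_mat_def], of dim_col] by simp
    ultimately show ?thesis
      using assms unfolding invertible_mat_def square_mat.simps by (intro carrier_matI) simp_all
  qed
  have A: "A \<in> carrier_mat (dim_row A) (dim_row A)"
    using assms unfolding invertible_mat_def by auto
  obtain B where B: "inverts_mat A B" "inverts_mat B A"
    using assms unfolding invertible_mat_def by blast
  have uniq: "C = B" if C: "inverts_mat A C" "inverts_mat C A" for C
  proof -
    have "C = C * (A * B)"
      using right_mult_one_mat[OF dims[OF C]] B(1) unfolding inverts_mat_def by metis
    also have "\<dots> = (C * A) * B"
      by (rule assoc_mult_mat[OF dims[OF C] A dims[OF B], symmetric])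
    also have "\<dots> = B"
      using left_mult_one_mat[OF dims[OF B]] C(2) carrier_matD(1)[OF dims[OF C]]
      unfolding inverts_mat_def by metis
    finally show ?thesis .
  qed
  have "inverts_mat A (mat_inv A) \<and> inverts_mat (mat_inv A) A"
    unfolding mat_inv_def by (rule theI[where a = B]) (use B uniq in blast)+
  then show "inverts_mat A (mat_inv A)" "inverts_mat (mat_inv A) A" by auto
qed

text \<open>Integer powers; for negative exponents meaningful only if the matrix is invertible.\<close>

definition mat_powi :: "complex mat \<Rightarrow> int \<Rightarrow> complex mat" where
  "mat_powi A r = (if r \<ge> 0 then A ^\<^sub>m nat r else mat_inv A ^\<^sub>m nat (- r))"

definition cheb_T :: "real \<Rightarrow> real \<Rightarrow> real" where
  "cheb_T \<nu> x = cos (\<nu> * arccos x)"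

definition eig :: "nat \<Rightarrow> complex \<Rightarrow> complex \<Rightarrow> nat \<Rightarrow> complex" where
  "eig n a b k = a + 2 * b * of_real (cos ((real k - 1) * pi / real n))"

text \<open>The argument of the Chebyshev functions is the complex number \<open>(\<lambda>\<^sub>k - a) / (2 b)\<close>.
  It is real and lies in \<open>[-1, 1]\<close>, so taking the real part only changes its type;
  see \<open>eig_arg_real\<close>.\<close>

definition eig_arg :: "nat \<Rightarrow> complex \<Rightarrow> complex \<Rightarrow> nat \<Rightarrow> real" where
  "eig_arg n a b k = Re ((eig n a b k - a) / (2 * b))"

lemma eig_arg_real:
  assumes "b \<noteq> 0"
  shows "of_real (eig_arg n a b k) = (eig n a b k - a) / (2 * b)"
    and "eig_arg n a b k = cos ((real k - 1) * pi / real n)"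
    and "eig_arg n a b k \<in> {-1..1}"
proof -
  have "(eig n a b k - a) / (2 * b) = of_real (cos ((real k - 1) * pi / real n))"
    using assms by (simp add: eig_def)
  then show "of_real (eig_arg n a b k) = (eig n a b k - a) / (2 * b)"
    and "eig_arg n a b k = cos ((real k - 1) * pi / real n)"
    and "eig_arg n a b k \<in> {-1..1}"
    by (simp_all add: eig_arg_def)
qed

definition wt :: "nat \<Rightarrow> nat \<Rightarrow> real" where
  "wt n k = (if k = 1 then 1 / real n else 2 / real n)"

end

theory Submission
  imports Defs
begin

text \<open>The vectors \<open>c\<^sub>m(i) = cos ((2i + 1) m \<pi> / (2n))\<close>, \<open>0 \<le> i < n\<close>, of the discrete cosine transform
  satisfy \<open>c\<^sub>m(i - 1) + c\<^sub>m(i + 1) = 2 cos (m \<pi> / n) c\<^sub>m(i)\<close> together with the reflecting boundary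
  conditions \<open>c\<^sub>m(-1) = c\<^sub>m(0)\<close> and \<open>c\<^sub>m(n) = c\<^sub>m(n - 1)\<close>, so they are eigenvectors of the tridiagonal
  matrix. Since \<open>c\<^sub>m(n - 1 - i) = (-1)\<^sup>m c\<^sub>m(i)\<close>, the exchange matrix only contributes a sign: the
  eigenvalues of the anti-tridiagonal matrix are \<open>(-1)\<^sup>m \<lambda>\<close>. With the weights \<open>f\<close> the vectors form an
  orthonormal system (by the Dirichlet kernel), which gives the spectral resolution of all powers.\<close>

definition dct :: "nat \<Rightarrow> nat \<Rightarrow> real \<Rightarrow> real" where
  "dct n m x = cos ((2 * x + 1) * (real m * pi / (2 * real n)))"

text \<open>The frequency \<open>m\<close> counts from 0 while \<open>eig\<close> and
  \<open>wt\<close> count from 1, hence \<open>Suc m\<close> here and below.\<close>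

definition anti_eig :: "nat \<Rightarrow> complex \<Rightarrow> complex \<Rightarrow> nat \<Rightarrow> complex" where
  "anti_eig n a b m = (-1) ^ m * eig n a b (Suc m)"

text \<open>With \<open>C\<close> the matrix whose row \<open>m\<close> is the cosine vector of
  frequency \<open>m\<close>, this is the transpose of \<open>C\<close>, times the diagonal matrix
  with entries \<open>wt n (Suc m) * g m\<close>, times \<open>C\<close>. It plays the role of a
  function of the anti-tridiagonal matrix, with value \<open>g m\<close> at frequency
  \<open>m\<close>.\<close>

definition spectral_mat :: "nat \<Rightarrow> (nat \<Rightarrow> complex) \<Rightarrow> complex mat" where
  "spectral_mat n g = mat n n (\<lambda>(i, j). \<Sum>m<n. of_real (wt n (Suc m)) * g m
     * of_real (dct n m (real i)) * of_real (dct n m (real j)))"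

lemma spectral_mat_carrier [simp]: "spectral_mat n g \<in> carrier_mat n n"
  by (simp add: spectral_mat_def)

lemma tridiag_mat_carrier [simp]: "tridiag_mat n a b \<in> carrier_mat n n"
  by (simp add: tridiag_mat_def)

lemma exchange_mat_carrier [simp]: "exchange_mat n \<in> carrier_mat n n"
  by (simp add: exchange_mat_def)

lemma antitridiag_mat_carrier [simp]: "antitridiag_mat n a b \<in> carrier_mat n n"
  unfolding antitridiag_mat_def by (rule mult_carrier_mat[OF exchange_mat_carrier tridiag_mat_carrier])

section \<open>Symmetries and recurrence of the cosine vectors\<close>

lemma dct_reflect:
  assumes "n > 0"
  shows "dct n m (real n - 1 - x) = (-1) ^ m * dct n m x"
proof -
  \<comment> \<open>Reflecting the position replaces the angle by its difference from
    \<open>real m * pi\<close>, which costs only the sign of cosine at that multiple of pi.\<close>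
  have "(2 * (real n - 1 - x) + 1) * (real m * pi / (2 * real n))
      = real m * pi - (2 * x + 1) * (real m * pi / (2 * real n))"
    using assms by (simp add: field_simps)
  then show ?thesis
    by (simp add: dct_def cos_diff)
qed

text \<open>The angles at -1 and 0 are opposite and cosine is even. Positions are real numbers so
  that ghost positions such as -1 make sense.\<close>

lemma dct_minus_one: "dct n m (-1) = dct n m 0"
  by (simp add: dct_def)

text \<open>Reflection carries -1 to \<open>n\<close> and 0 to \<open>n - 1\<close>, so the right
  boundary condition mirrors the left one.\<close>

lemma dct_n:
  assumes "n > 0"
  shows "dct n m (real n) = dct n m (real n - 1)"
  using dct_reflect[OF assms, of m "-1"] dct_reflect[OF assms, of m 0]
  by (simp add: dct_minus_one)

text \<open>A unit step in \<open>x\<close> changes the angle by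
  \<open>real m * pi / real n\<close>, and the sine terms of the two addition formulas
  cancel.\<close>

lemma dct_recurrence:
  "dct n m (x - 1) + dct n m (x + 1) = 2 * cos (real m * pi / real n) * dct n m x"
proof -
  define \<theta> where "\<theta> = real m * pi / (2 * real n)"
  have "real m * pi / real n = 2 * \<theta>"
    by (simp add: \<theta>_def)
  moreover have "(2 * (x - 1) + 1) * \<theta> = (2 * x + 1) * \<theta> - 2 * \<theta>"
    "(2 * (x + 1) + 1) * \<theta> = (2 * x + 1) * \<theta> + 2 * \<theta>"
    by (simp_all add: algebra_simps)
  ultimately show ?thesis
    unfolding dct_def \<theta>_def[symmetric] by (simp add: cos_add cos_diff)
qed

text \<open>The angle at position 0 lies in the interval from 0 to below pi/2. This certifies that
  the cosine vector is nonzero.\<close>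

lemma dct_zero_pos:
  assumes "m < n"
  shows "dct n m 0 > 0"
proof -
  have "real m * pi / (2 * real n) < pi / 2"
    using assms by (simp add: field_simps)
  moreover have "0 \<le> real m * pi / (2 * real n)"
    by simp
  ultimately show ?thesis
    unfolding dct_def by (intro cos_gt_zero_pi) (auto simp: less_le_trans[of _ 0])
qed

section \<open>Left eigenvectors of the tridiagonal and anti-tridiagonal matrices\<close>

lemma dct_mult_tridiag:
  assumes n: "n \<ge> 2" and j: "j < n"
  shows "(\<Sum>l<n. of_real (dct n m (real l)) * tridiag_mat n a b $$ (l, j))
    = eig n a b (Suc m) * of_real (dct n m (real j))"
proof -
  define c :: "real \<Rightarrow> complex" where "c = (\<lambda>x. of_real (dct n m x))"
  \<comment> \<open>Column \<open>j\<close> is split into the diagonal \<open>a\<close>, the two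
    corner corrections and the two neighbours. The case \<open>j = 0\<close> is cut out of the upper
    neighbour because \<open>j - 1\<close> truncates to 0 there and would hit the diagonal.\<close>
  have "(\<Sum>l<n. c (real l) * tridiag_mat n a b $$ (l, j))
      = (\<Sum>l<n. (if l = j then a * c (real l) else 0)
          + (if l = j then (if j = 0 then b * c (real l) else 0) else 0)
          + (if l = j then (if j = n - 1 then b * c (real l) else 0) else 0)
          + (if l = j - 1 then (if j = 0 then 0 else b * c (real l)) else 0)
          + (if l = j + 1 then b * c (real l) else 0))"
    using n j by (intro sum.cong) (auto simp: tridiag_mat_def algebra_simps)
  also have "\<dots> = a * c (real j) + (if j = 0 then b * c (real j) else b * c (real (j - 1)))
      + (if j = n - 1 then b * c (real j) else b * c (real (j + 1)))"
    using n j by (simp add: sum.distrib less_diff_conv2) auto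
  \<comment> \<open>By the boundary conditions, the corner corrections supply exactly the missing
    neighbours at positions -1 and \<open>n\<close>.\<close>
  also have "\<dots> = a * c (real j) + b * c (real j - 1) + b * c (real j + 1)"
  proof -
    have "c (real j) = c (real j - 1)" if "j = 0"
      using that by (simp add: c_def dct_minus_one)
    moreover have "c (real j) = c (real j + 1)" if "j = n - 1"
      using that n dct_n[of n m] by (simp add: c_def of_nat_diff)
    ultimately show ?thesis
      by (auto simp: of_nat_diff add.commute)
  qed
  also have "\<dots> = a * c (real j) + b * (c (real j - 1) + c (real j + 1))"
    by (simp add: algebra_simps)
  also have "c (real j - 1) + c (real j + 1)
      = 2 * of_real (cos (real m * pi / real n)) * c (real j)"
    unfolding c_def of_real_add[symmetric] dct_recurrence by simp
  finally show ?thesis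
    by (simp add: c_def eig_def algebra_simps)
qed

lemma antitridiag_mat_index:
  assumes "i < n" "j < n"
  shows "antitridiag_mat n a b $$ (i, j) = tridiag_mat n a b $$ (n - Suc i, j)"
proof -
  have "antitridiag_mat n a b $$ (i, j)
      = (\<Sum>k = 0..<n. exchange_mat n $$ (i, k) * tridiag_mat n a b $$ (k, j))"
    using assms carrier_matD[OF exchange_mat_carrier[of n]]
      carrier_matD[OF tridiag_mat_carrier[of n a b]]
    by (simp add: antitridiag_mat_def scalar_prod_def)
  also have "\<dots> = (\<Sum>k = 0..<n. if k = n - Suc i then tridiag_mat n a b $$ (k, j) else 0)"
    using assms by (intro sum.cong) (auto simp: exchange_mat_def)
  finally show ?thesis
    using assms by simp
qed

text \<open>Summing in reverse order undoes the row reversal by the exchange matrix and reflects the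
  vector instead, which produces the sign in \<open>anti_eig\<close>.\<close>

lemma dct_mult_antitridiag:
  assumes n: "n \<ge> 2" and j: "j < n"
  shows "(\<Sum>l<n. of_real (dct n m (real l)) * antitridiag_mat n a b $$ (l, j))
    = anti_eig n a b m * of_real (dct n m (real j))"
proof -
  have "(\<Sum>l<n. of_real (dct n m (real l)) * antitridiag_mat n a b $$ (l, j))
      = (\<Sum>l<n. of_real (dct n m (real (n - Suc l)))
          * antitridiag_mat n a b $$ (n - Suc l, j))"
    by (rule sum.nat_diff_reindex[symmetric])
  also have "\<dots> = (\<Sum>l<n. (-1) ^ m
      * (of_real (dct n m (real l)) * tridiag_mat n a b $$ (l, j)))"
  proof (rule sum.cong)
    fix l assume l: "l \<in> {..<n}"
    have "dct n m (real (n - Suc l)) = (-1) ^ m * dct n m (real l)"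
      using l dct_reflect[of n m "real l"] by (simp add: of_nat_diff algebra_simps)
    moreover have "n - Suc (n - Suc l) = l"
      using l by auto
    ultimately show "of_real (dct n m (real (n - Suc l)))
          * antitridiag_mat n a b $$ (n - Suc l, j)
        = (-1) ^ m * (of_real (dct n m (real l)) * tridiag_mat n a b $$ (l, j))"
      using l j by (simp add: antitridiag_mat_index)
  qed simp
  also have "\<dots> = anti_eig n a b m * of_real (dct n m (real j))"
    using dct_mult_tridiag[OF n j, of m a b]
    by (simp add: sum_distrib_left[symmetric] anti_eig_def)
  finally show ?thesis .
qed

text \<open>After the sums are swapped, the matrix acts on the right-hand cosine vector of each
  frequency separately, as on a left eigenvector.\<close>

lemma spectral_mat_mult_antitridiag:
  assumes n: "n \<ge> 2"
  shows "spectral_mat n g * antitridiag_mat n a b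
    = spectral_mat n (\<lambda>m. g m * anti_eig n a b m)" (is "?L = ?R")
proof (rule eq_matI)
  fix i j assume "i < dim_row ?R" "j < dim_col ?R"
  then have i: "i < n" and j: "j < n"
    by (simp_all add: spectral_mat_def)
  let ?w = "\<lambda>m. of_real (wt n (Suc m)) * g m * of_real (dct n m (real i)) :: complex"
  have "?L $$ (i, j) = (\<Sum>l<n. spectral_mat n g $$ (i, l) * antitridiag_mat n a b $$ (l, j))"
    using i j carrier_matD[OF antitridiag_mat_carrier[of n a b]]
    by (simp add: scalar_prod_def spectral_mat_def lessThan_atLeast0)
  also have "\<dots> = (\<Sum>l<n. \<Sum>m<n. ?w m
      * (of_real (dct n m (real l)) * antitridiag_mat n a b $$ (l, j)))"
    using i by (simp add: spectral_mat_def sum_distrib_right mult.assoc)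
  also have "\<dots> = (\<Sum>m<n. ?w m
      * (\<Sum>l<n. of_real (dct n m (real l)) * antitridiag_mat n a b $$ (l, j)))"
    by (subst sum.swap) (simp add: sum_distrib_left)
  also have "\<dots> = ?R $$ (i, j)"
    using i j by (simp add: dct_mult_antitridiag[OF n j] spectral_mat_def mult_ac)
  finally show "?L $$ (i, j) = ?R $$ (i, j)" .
qed (use carrier_matD[OF antitridiag_mat_carrier[of n a b]] in \<open>simp_all add: spectral_mat_def\<close>)

section \<open>Dirichlet kernel and orthogonality\<close>

lemma dirichlet_kernel:
  fixes x :: real
  shows "sin (x / 2) * (1 + 2 * (\<Sum>m=1..N. cos (real m * x))) = sin ((real N + 1 / 2) * x)"
proof (induction N)
  case (Suc N)
  have "(real (Suc N) + 1 / 2) * x = real (Suc N) * x + x / 2"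
    "(real N + 1 / 2) * x = real (Suc N) * x - x / 2"
    by (simp_all add: field_simps)
  \<comment> \<open>Multiplied by \<open>2 * sin (x / 2)\<close>, each cosine becomes a difference
    of consecutive right-hand sides, so the sum telescopes.\<close>
  then have "sin ((real (Suc N) + 1 / 2) * x) - sin ((real N + 1 / 2) * x)
      = 2 * sin (x / 2) * cos (real (Suc N) * x)"
    by (simp only: sin_add sin_diff) simp
  with Suc.IH show ?case
    by (simp add: algebra_simps)
qed simp

text \<open>The halved weight at frequency 0 yields the shape of the Dirichlet kernel.\<close>

lemma weighted_sum_split:
  fixes h :: "nat \<Rightarrow> real"
  assumes "n > 0"
  shows "(\<Sum>m<n. wt n (Suc m) * h m) = (h 0 + 2 * (\<Sum>m=1..n-1. h m)) / real n"
proof -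
  obtain N where n: "n = Suc N"
    using assms gr0_conv_Suc by auto
  have "(\<Sum>m<n. wt n (Suc m) * h m)
      = wt n 1 * h 0 + (\<Sum>m<N. wt n (Suc (Suc m)) * h (Suc m))"
    unfolding n by (subst sum.lessThan_Suc_shift) simp
  also have "(\<Sum>m<N. wt n (Suc (Suc m)) * h (Suc m)) = 2 / real n * (\<Sum>m<N. h (Suc m))"
    by (simp add: wt_def sum_distrib_left)
  also have "(\<Sum>m<N. h (Suc m)) = (\<Sum>m=1..n-1. h m)"
    unfolding n by (simp add: sum.atLeast1_atMost_eq)
  finally show ?thesis
    by (simp add: wt_def add_divide_distrib)
qed

lemma weighted_cos_sum:
  assumes "0 < p" "p < 2 * n"
  shows "(\<Sum>m<n. wt n (Suc m) * cos (real p * (real m * pi / real n)))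
    = - ((-1) ^ p) / real n"
proof -
  define x where "x = real p * pi / real n"
  have n: "n > 0"
    using assms by auto
  \<comment> \<open>The two bounds on \<open>p\<close> are what make \<open>sin (x / 2)\<close>
    nonzero, so that it can be cancelled from the kernel identity.\<close>
  have "0 < x / 2" "x / 2 < pi"
    using assms n by (simp_all add: x_def field_simps flip: of_nat_less_iff)
  then have sin: "sin (x / 2) > 0"
    by (rule sin_gt_zero)
  have "(real (n - 1) + 1 / 2) * x = real p * pi - x / 2"
    using n by (simp add: x_def of_nat_diff field_simps)
  then have "sin ((real (n - 1) + 1 / 2) * x) = sin (x / 2) * - ((-1) ^ p)"
    by (simp add: sin_diff)
  with dirichlet_kernel[of x "n - 1"] sin
  have "1 + 2 * (\<Sum>m=1..n-1. cos (real m * x)) = - ((-1) ^ p)"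
    by (metis less_irrefl mult_left_cancel)
  moreover have "real p * (real m * pi / real n) = real m * x" for m
    by (simp add: x_def)
  ultimately show ?thesis
    by (simp add: weighted_sum_split[OF n])
qed

text \<open>This is the cosine sum for \<open>p = 0\<close>, the value left out of
  \<open>weighted_cos_sum\<close>; it arises from equal positions.\<close>

lemma weighted_sum_one:
  assumes "n > 0"
  shows "(\<Sum>m<n. wt n (Suc m)) = 2 - 1 / real n"
  using weighted_sum_split[OF assms, of "\<lambda>_. 1"] assms
  by (simp add: of_nat_diff field_simps)

text \<open>The product-to-sum formula reduces this to the cosine sums for \<open>j - i\<close> and
  \<open>i + j + 1\<close>. The sum runs over frequencies rather than positions, so it directly
  gives the resolution of the identity.\<close>

lemma dct_orthogonal:
  assumes i: "i < n" and j: "j < n"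
  shows "(\<Sum>m<n. wt n (Suc m) * (dct n m (real i) * dct n m (real j)))
    = (if i = j then 1 else 0)"
  using i j
proof (induction i j rule: linorder_wlog)
  \<comment> \<open>With \<open>i \<le> j\<close>, the difference \<open>j - i\<close> is not
    truncated.\<close>
  case (le i j)
  define S where "S = (\<lambda>p. \<Sum>m<n. wt n (Suc m) * cos (real p * (real m * pi / real n)))"
  have prod: "dct n m (real i) * dct n m (real j) = (cos (real (j - i) * (real m * pi / real n))
      + cos (real (i + j + 1) * (real m * pi / real n))) / 2" for m
  proof -
    define \<theta> where "\<theta> = real m * pi / (2 * real n)"
    have "real m * pi / real n = 2 * \<theta>"
      by (simp add: \<theta>_def)
    moreover have "(2 * real j + 1) * \<theta> - (2 * real i + 1) * \<theta> = real (j - i) * (2 * \<theta>)"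
      "(2 * real j + 1) * \<theta> + (2 * real i + 1) * \<theta> = real (i + j + 1) * (2 * \<theta>)"
      using le by (simp_all add: of_nat_diff algebra_simps)
    ultimately show ?thesis
      using cos_times_cos[of "(2 * real j + 1) * \<theta>" "(2 * real i + 1) * \<theta>"]
      unfolding dct_def \<theta>_def[symmetric] by (simp add: mult.commute)
  qed
  have "(\<Sum>m<n. wt n (Suc m) * (dct n m (real i) * dct n m (real j)))
      = (S (j - i) + S (i + j + 1)) / 2"
    unfolding prod S_def by (simp add: sum.distrib[symmetric] sum_divide_distrib algebra_simps)
  moreover have "S (i + j + 1) = - ((-1) ^ (i + j + 1)) / real n"
    unfolding S_def using le by (intro weighted_cos_sum) auto
  moreover have "S (j - i) = - ((-1) ^ (j - i)) / real n" if "i \<noteq> j"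
    unfolding S_def using le that by (intro weighted_cos_sum) auto
  moreover have "S 0 = 2 - 1 / real n"
    unfolding S_def using le weighted_sum_one[of n] by simp
  \<comment> \<open>The two arguments differ by the odd number \<open>2 * i + 1\<close>, so their
    sums cancel off the diagonal; on it, the terms with denominator \<open>real n\<close> cancel and
    2 / 2 remains.\<close>
  moreover have "(-1) ^ (i + j + 1) = - ((-1) ^ (j - i) :: real)"
    using le by (simp add: minus_one_power_iff)
  ultimately show ?case
    by (cases "i = j") (simp_all add: power_add)
next
  case (sym i j)
  then show ?case
    by (simp add: mult.commute eq_commute)
qed

section \<open>Spectral resolution of integer powers\<close>

lemma spectral_mat_one: "spectral_mat n (\<lambda>_. 1) = 1\<^sub>m n"
proof (rule eq_matI)
  fix i j assume "i < dim_row (1\<^sub>m n)" "j < dim_col (1\<^sub>m n)"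
  then have ij: "i < n" "j < n"
    by simp_all
  have "spectral_mat n (\<lambda>_. 1) $$ (i, j)
      = of_real (\<Sum>m<n. wt n (Suc m) * (dct n m (real i) * dct n m (real j)))"
    using ij by (simp add: spectral_mat_def mult.assoc)
  then show "spectral_mat n (\<lambda>_. 1) $$ (i, j) = 1\<^sub>m n $$ (i, j)"
    using ij by (simp add: dct_orthogonal)
qed (simp_all add: spectral_mat_def)

lemma antitridiag_mat_pow:
  assumes "n \<ge> 2"
  shows "antitridiag_mat n a b ^\<^sub>m s = spectral_mat n (\<lambda>m. anti_eig n a b m ^ s)"
proof (induction s)
  case 0
  then show ?case
    using carrier_matD[OF antitridiag_mat_carrier[of n a b]] by (simp add: spectral_mat_one)
next
  case (Suc s)
  then show ?case
    using assms by (simp add: spectral_mat_mult_antitridiag mult.commute)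
qed

lemma mat_inv_carrier:
  assumes A: "A \<in> carrier_mat n n" and inv: "invertible_mat A"
  shows "mat_inv A \<in> carrier_mat n n" "A * mat_inv A = 1\<^sub>m n"
proof -
  note * = mat_inv[OF inv, unfolded inverts_mat_def]
  show "mat_inv A \<in> carrier_mat n n"
    using arg_cong[OF *(1), of dim_col] arg_cong[OF *(2), of dim_col] A by auto
  show "A * mat_inv A = 1\<^sub>m n"
    using *(1) A by auto
qed

text \<open>A zero eigenvalue would let the matrix annihilate the row vector \<open>?c\<close>;
  multiplying by the inverse would give \<open>?c = 0\<close>, against its positive first
  entry.\<close>

lemma anti_eig_nonzero:
  assumes n: "n \<ge> 2" and inv: "invertible_mat (antitridiag_mat n a b)" and m: "m < n"
  shows "anti_eig n a b m \<noteq> 0"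
proof
  assume zero: "anti_eig n a b m = 0"
  let ?B = "antitridiag_mat n a b"
  let ?c = "mat 1 n (\<lambda>(_, l). of_real (dct n m (real l))) :: complex mat"
  note B = antitridiag_mat_carrier[of n a b]
  note Binv = mat_inv_carrier[OF B inv]
  have c: "?c \<in> carrier_mat 1 n"
    by simp
  have "?c * ?B = 0\<^sub>m 1 n"
  proof (rule eq_matI)
    fix i j assume "i < dim_row (0\<^sub>m 1 n)" "j < dim_col (0\<^sub>m 1 n)"
    then have "i = 0" "j < n"
      by simp_all
    then show "(?c * ?B) $$ (i, j) = 0\<^sub>m 1 n $$ (i, j)"
      using dct_mult_antitridiag[OF n \<open>j < n\<close>, of m a b] carrier_matD[OF B] zero
      by (simp add: scalar_prod_def lessThan_atLeast0)
  qed (use carrier_matD[OF B] in simp_all)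
  then have "?c = 0\<^sub>m 1 n"
    using assoc_mult_mat[OF c B Binv(1)] right_mult_one_mat[OF c] Binv by simp
  then have "?c $$ (0, 0) = 0"
    using m by simp
  then show False
    using m dct_zero_pos[OF m] by simp
qed

lemma spectral_mat_cong:
  assumes "\<And>m. m < n \<Longrightarrow> g m = h m"
  shows "spectral_mat n g = spectral_mat n h"
  unfolding spectral_mat_def using assms by simp

lemma antitridiag_mat_inv_pow:
  assumes n: "n \<ge> 2" and inv: "invertible_mat (antitridiag_mat n a b)"
  shows "mat_inv (antitridiag_mat n a b) ^\<^sub>m s
    = spectral_mat n (\<lambda>m. inverse (anti_eig n a b m) ^ s)"
proof (induction s)
  case 0
  then show ?case
    using carrier_matD[OF mat_inv_carrier(1)[OF antitridiag_mat_carrier inv]]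
    by (simp add: spectral_mat_one)
next
  case (Suc s)
  let ?B = "antitridiag_mat n a b"
  let ?S = "\<lambda>s. spectral_mat n (\<lambda>m. inverse (anti_eig n a b m) ^ s)"
  note B = antitridiag_mat_carrier[of n a b]
  note Binv = mat_inv_carrier[OF B inv]
  \<comment> \<open>Multiplying the claimed next power by \<open>?B\<close> cancels one inverse
    eigenvalue per frequency; \<open>?B\<close> is then moved across by its inverse.\<close>
  have "?S (Suc s) * ?B = ?S s"
    unfolding spectral_mat_mult_antitridiag[OF n]
    using anti_eig_nonzero[OF n inv] by (intro spectral_mat_cong) simp
  then have "?S s * mat_inv ?B = ?S (Suc s) * (?B * mat_inv ?B)"
    using assoc_mult_mat[OF spectral_mat_carrier B Binv(1)] by metis
  also have "\<dots> = ?S (Suc s)"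
    unfolding Binv(2) by (rule right_mult_one_mat[OF spectral_mat_carrier])
  finally show ?case
    using Suc.IH by simp
qed

lemma antitridiag_mat_powi:
  assumes "n \<ge> 2" and "r \<ge> 0 \<or> invertible_mat (antitridiag_mat n a b)"
  shows "mat_powi (antitridiag_mat n a b) r = spectral_mat n (\<lambda>m. anti_eig n a b m powi r)"
  using assms
  by (auto simp: mat_powi_def antitridiag_mat_pow antitridiag_mat_inv_pow power_int_def)

section \<open>Translation into Chebyshev functions\<close>

lemma cheb_T_eig_arg:
  assumes "b \<noteq> 0" "m < n"
  shows "cheb_T (x + 1 / 2) (eig_arg n a b (Suc m)) = dct n m x"
proof -
  \<comment> \<open>As \<open>m < n\<close>, the angle lies between 0 and pi, where
    \<open>arccos\<close> inverts cosine.\<close>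
  have "arccos (cos (real m * pi / real n)) = real m * pi / real n"
    using assms by (intro arccos_cos) (simp_all add: field_simps)
  then have "arccos (eig_arg n a b (Suc m)) = real m * pi / real n"
    using assms by (simp add: eig_arg_real(2))
  then show ?thesis
    by (simp add: cheb_T_def dct_def field_simps)
qed

text \<open>The sign survives exactly for odd exponents, negative ones included; this is the source
  of the two cases of the theorem.\<close>

lemma anti_eig_powi:
  "anti_eig n a b m powi r = (if even r then 1 else (-1) ^ m) * eig n a b (Suc m) powi r"
  by (cases "even m") (auto simp: anti_eig_def power_int_mult_distrib power_int_minus_left)

theorem theorem4:
  fixes n :: nat and a b :: complex and r :: int and i j :: nat
  assumes "n \<ge> 2" and "b \<noteq> 0"
    and "r \<ge> 0 \<or> invertible_mat (antitridiag_mat n a b)"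
    and "i \<in> {1..n}" and "j \<in> {1..n}"
  shows "mat_powi (antitridiag_mat n a b) r $$ (i - 1, j - 1) =
    (if even r then
       (\<Sum>k = 1..n. of_real (wt n k) * eig n a b k powi r
          * of_real (cheb_T ((2 * real i - 1) / 2) (eig_arg n a b k))
          * of_real (cheb_T ((2 * real j - 1) / 2) (eig_arg n a b k)))
     else
       (\<Sum>k = 1..n. of_real (wt n k) * eig n a b k powi r
          * of_real (cheb_T ((2 * (real n - real i) + 1) / 2) (eig_arg n a b k))
          * of_real (cheb_T ((2 * real j - 1) / 2) (eig_arg n a b k))))"
proof -
  have idx: "i - 1 < n" "j - 1 < n"
    and real_idx: "real (i - 1) = real i - 1" "real (j - 1) = real j - 1"
    using assms by auto
  \<comment> \<open>Position \<open>real l - 1\<close> reflects to \<open>real n - real l\<close>,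
    so the second Chebyshev index carries the sign \<open>(-1) ^ m\<close> that odd powers of
    \<open>anti_eig\<close> produce.\<close>
  have cheb: "cheb_T ((2 * real l - 1) / 2) (eig_arg n a b (Suc m)) = dct n m (real l - 1)"
    "cheb_T ((2 * (real n - real l) + 1) / 2) (eig_arg n a b (Suc m))
      = (-1) ^ m * dct n m (real l - 1)" if "m < n" for l m
    using cheb_T_eig_arg[OF \<open>b \<noteq> 0\<close> that, of "real l - 1" a]
      cheb_T_eig_arg[OF \<open>b \<noteq> 0\<close> that, of "real n - real l" a]
      dct_reflect[of n m "real l - 1"] that
    by (simp_all add: diff_divide_distrib add_divide_distrib algebra_simps)
  have "mat_powi (antitridiag_mat n a b) r $$ (i - 1, j - 1)
      = (\<Sum>m<n. of_real (wt n (Suc m)) * anti_eig n a b m powi r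
          * of_real (dct n m (real i - 1)) * of_real (dct n m (real j - 1)))"
    unfolding antitridiag_mat_powi[OF assms(1,3)] using idx
    by (simp add: spectral_mat_def real_idx del: One_nat_def)
  then show ?thesis
    by (cases "even r") (simp_all add: sum.atLeast1_atMost_eq cheb anti_eig_powi
          del: right_diff_distrib_numeral,
        simp_all add: mult_ac)
qed

end
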